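(* Let $\Sigma$ be a (possibly infinite) unranked signature, $\mathcal{X}$ an infinite set of variables disjoint from $\Sigma$, and $>$ a well-founded partial order on $\Sigma$. Let $\rightsquigarrow$ be the rewrite relation induced by the term rewrite system $\mathit{Star}$ on the terms $\mathcal{T}(\Sigma\cup\Sigma^\star,\mathcal{X})$. Then for no (star-free) term $t\in\mathcal{T}(\Sigma,\mathcal{X})$ do we have $t\mathrel{(\rightsquigarrow^+\cdot\simeq)}t$; that is, there are no $t\in\mathcal{T}(\Sigma,\mathcal{X})$ and term $t'$ with $t\rightsquigarrow^+t'$ and $t'\simeq t$.
   Context: Terms: for an unranked signature $\Gamma$ (a set of symbols without fixed arity) and a set $\mathcal{X}$ of variables disjoint from $\Gamma$, the set of terms $\mathcal{T}(\Gamma,\mathcal{X})$ is the smallest set containing $\mathcal{X}$ and containing $f(t_1,\ldots,t_n)$ for all $f\in\Gamma$, $n\ge 0$ and terms $t_1,\ldots,t_n$; the order of arguments matters. A term rewrite system is a set of rules $\ell\to r$; it induces on terms the rewrite relation $C[\sigma(\ell)]\to C[\sigma(r)]$ for all one-hole contexts $C$, rules $\ell\to r$ and substitutions $\sigma$. $\simeq$ is the equivalence relation on terms generated by swapping two adjacent arguments of a symbol anywhere inside a term, i.e. generated by the rewrite rules $f(\vec u,x,y,\vec w)\to f(\vec u,y,x,\vec w)$ for all symbols $f$. Starred signature: $\Sigma^\star=\{f^\star\mid f\in\Sigma\}$, a set of fresh symbols (disjoint from $\Sigma$). The system $\mathit{Star}$ over $\Sigma\cup\Sigma^\star$ consists of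 the following rules, for all $f,g\in\Sigma$, where $\vec x,\vec y,\vec z$ are finite (possibly empty) vectors of distinct variables: (put) $f(\vec x)\rightsquigarrow f^\star(\vec x)$; (select) $f^\star(\vec x,y,\vec z)\rightsquigarrow y$; (copy) $f^\star(\vec x)\rightsquigarrow g(f^\star(\vec x),\ldots,f^\star(\vec x))$ with $0$ or more copies of $f^\star(\vec x)$, if $f>g$; (down) $f^\star(\vec x,g(\vec y),\vec z)\rightsquigarrow f(\vec x,g^\star(\vec y),\ldots,g^\star(\vec y),\vec z)$ with $0$ or more copies of $g^\star(\vec y)$. *)

theory Defs
  imports Main
begin

text \<open>Function symbols carry no arity: the length of the argument list is unconstrained.\<close>

datatype ('f, 'v) trm = Var 'v | Fun 'f "('f, 'v) trm list"

inductive_set terms :: "'f set \<Rightarrow> 'v set \<Rightarrow> ('f, 'v) trm set" for G V where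
  "x \<in> V \<Longrightarrow> Var x \<in> terms G V"
| "\<lbrakk>f \<in> G; \<And>t. t \<in> set ts \<Longrightarrow> t \<in> terms G V\<rbrakk> \<Longrightarrow> Fun f ts \<in> terms G V"

primrec subst :: "('v \<Rightarrow> ('f, 'v) trm) \<Rightarrow> ('f, 'v) trm \<Rightarrow> ('f, 'v) trm" where
  "subst \<sigma> (Var x) = \<sigma> x"
| "subst \<sigma> (Fun f ts) = Fun f (map (subst \<sigma>) ts)"

datatype ('f, 'v) ctxt =
  Hole
| More 'f "('f, 'v) trm list" "('f, 'v) ctxt" "('f, 'v) trm list"

inductive_set ctxts :: "'f set \<Rightarrow> 'v set \<Rightarrow> ('f, 'v) ctxt set" for G V where
  "Hole \<in> ctxts G V"
| "\<lbrakk>f \<in> G; set ss \<subseteq> terms G V; C \<in> ctxts G V; set ts \<subseteq> terms G V\<rbrakk>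
    \<Longrightarrow> More f ss C ts \<in> ctxts G V"

primrec fill :: "('f, 'v) ctxt \<Rightarrow> ('f, 'v) trm \<Rightarrow> ('f, 'v) trm" where
  "fill Hole t = t"
| "fill (More f ss C ts) t = Fun f (ss @ fill C t # ts)"

text \<open>The rewrite relation on \<open>terms G V\<close> induced by rules \<open>R\<close> whose variables lie in \<open>V\<close>;
  the values of \<open>\<sigma>\<close> outside \<open>V\<close> are then irrelevant.\<close>

inductive rstep ::
  "'f set \<Rightarrow> 'v set \<Rightarrow> (('f, 'v) trm \<times> ('f, 'v) trm) set \<Rightarrow> ('f, 'v) trm \<Rightarrow> ('f, 'v) trm \<Rightarrow> bool"
  for G V R where
  "\<lbrakk>(l, r) \<in> R; C \<in> ctxts G V; \<sigma> ` V \<subseteq> terms G V\<rbrakk>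
    \<Longrightarrow> rstep G V R (fill C (subst \<sigma> l)) (fill C (subst \<sigma> r))"

inductive_set swap_rules :: "'f set \<Rightarrow> 'v set \<Rightarrow> (('f, 'v) trm \<times> ('f, 'v) trm) set" for G V where
  "\<lbrakk>f \<in> G; distinct (us @ x # y # ws); set (us @ x # y # ws) \<subseteq> V\<rbrakk>
    \<Longrightarrow> (Fun f (map Var (us @ x # y # ws)), Fun f (map Var (us @ y # x # ws))) \<in> swap_rules G V"

text \<open>Since \<^const>\<open>equivclp\<close> is reflexive on the whole type, this relates terms outside
  \<open>terms G V\<close> to themselves, but to nothing else.\<close>

definition perm_equiv :: "'f set \<Rightarrow> 'v set \<Rightarrow> ('f, 'v) trm \<Rightarrow> ('f, 'v) trm \<Rightarrow> bool" where
  "perm_equiv G V = equivclp (rstep G V (swap_rules G V))"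

datatype 'f sym = Plain 'f | Starred 'f

definition star_sig :: "'f set \<Rightarrow> 'f sym set" where
  "star_sig F = Plain ` F \<union> Starred ` F"

inductive_set star_rules ::
  "'f set \<Rightarrow> 'v set \<Rightarrow> ('f \<Rightarrow> 'f \<Rightarrow> bool) \<Rightarrow> (('f sym, 'v) trm \<times> ('f sym, 'v) trm) set"
  for F V gt where
  put: "\<lbrakk>f \<in> F; distinct xs; set xs \<subseteq> V\<rbrakk>
    \<Longrightarrow> (Fun (Plain f) (map Var xs), Fun (Starred f) (map Var xs)) \<in> star_rules F V gt"
| select: "\<lbrakk>f \<in> F; distinct (xs @ y # zs); set (xs @ y # zs) \<subseteq> V\<rbrakk>
    \<Longrightarrow> (Fun (Starred f) (map Var (xs @ y # zs)), Var y) \<in> star_rules F V gt"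
| copy: "\<lbrakk>f \<in> F; g \<in> F; gt f g; distinct xs; set xs \<subseteq> V\<rbrakk>
    \<Longrightarrow> (Fun (Starred f) (map Var xs),
         Fun (Plain g) (replicate n (Fun (Starred f) (map Var xs)))) \<in> star_rules F V gt"
| down: "\<lbrakk>f \<in> F; g \<in> F; distinct (xs @ ys @ zs); set (xs @ ys @ zs) \<subseteq> V\<rbrakk>
    \<Longrightarrow> (Fun (Starred f) (map Var xs @ Fun (Plain g) (map Var ys) # map Var zs),
         Fun (Plain f) (map Var xs @ replicate n (Fun (Starred g) (map Var ys)) @ map Var zs))
        \<in> star_rules F V gt"

definition star_step ::
  "'f set \<Rightarrow> 'v set \<Rightarrow> ('f \<Rightarrow> 'f \<Rightarrow> bool) \<Rightarrow> ('f sym, 'v) trm \<Rightarrow> ('f sym, 'v) trm \<Rightarrow> bool" where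
  "star_step F V gt = rstep (star_sig F) V (star_rules F V gt)"

end

theory Submission
  imports Defs "HOL-Library.Multiset" "HOL-Library.Extended_Nat"
begin

text \<open>
  Terms modulo \<open>\<simeq>\<close> are trees with multisets of arguments. Give every symbol of such a tree a label:
  \<open>\<infinity>\<close> for a plain symbol and a natural number for a starred one, which bounds the number of
  steps that the star may still perform. If a label strictly decreases with every use of the star,
  the relation becomes terminating: a node whose arguments are accessible is accessible, by
  lexicographic induction on its symbol, its multiset of arguments and its label. A step of \<open>Star\<close>
  lifts to a nonempty labelled reduction when the uniform label of all stars drops from \<open>n + 1\<close> to
  \<open>n\<close>. A cycle of length \<open>k\<close> on a star-free term would thus lift to a labelled cycle, starting from
  the label \<open>k\<close>, since a star-free term does not feel the label.
\<close>

section \<open>Labelled multiset trees and termination\<close>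

datatype ('f, 'v) mtree = MVar 'v | MFun 'f enat "('f, 'v) mtree multiset"

text \<open>The rule \<open>arg\<close> covers both rewriting inside an argument, where \<open>K\<close> is a singleton, and the rule
  \<open>down\<close>, where \<open>K\<close> consists of copies of \<open>t\<close> with a smaller label at the root; the rule
  \<open>relabel\<close> covers \<open>put\<close>.\<close>

inductive mstep :: "('f \<Rightarrow> 'f \<Rightarrow> bool) \<Rightarrow> ('f, 'v) mtree \<Rightarrow> ('f, 'v) mtree \<Rightarrow> bool" for gt where
  select: "t \<in># M \<Longrightarrow> mstep gt (MFun f a M) t"
| relabel: "b < a \<Longrightarrow> mstep gt (MFun f a M) (MFun f b M)"
| copy: "gt f g \<Longrightarrow> b < a \<Longrightarrow> mstep gt (MFun f a M) (MFun g c (replicate_mset n (MFun f b M)))"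
| arg: "(\<And>k. k \<in># K \<Longrightarrow> mstep gt t k) \<Longrightarrow> mstep gt (MFun f a (add_mset t M)) (MFun f b (M + K))"

inductive_cases mstep_MVarE: "mstep gt (MVar x) t"

text \<open>The symbol comes first because \<open>copy\<close> gives the new root an arbitrary
  label; the label comes last because \<open>arg\<close> may raise it, paid for by a smaller
  multiset.\<close>

lemma accp_mstep_MFun:
  assumes wf_gt: "wfp (\<lambda>g f. gt f g)"
    and "\<And>t. t \<in># M \<Longrightarrow> Wellfounded.accp (mstep gt)\<inverse>\<inverse> t"
  shows "Wellfounded.accp (mstep gt)\<inverse>\<inverse> (MFun f a M)"
proof -
  let ?A = "Wellfounded.accp (mstep gt)\<inverse>\<inverse> :: ('a, 'b) mtree \<Rightarrow> bool"
  \<comment> \<open>Only steps from accessible trees count, so \<open>r\<close> is well-founded in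
    advance: an inaccessible tree has no \<open>r\<close>-predecessor.\<close>
  define r where "r = {(t, s). mstep gt s t \<and> ?A s}"
  have "wf r"
    unfolding wf_def
  proof (intro allI impI)
    fix P and s
    assume step: "\<forall>s. (\<forall>t. (t, s) \<in> r \<longrightarrow> P t) \<longrightarrow> P s"
    have "P s" if "?A s" for s
      using that by (induction rule: accp.induct) (use step r_def in auto)
    moreover have "P s" if "\<not> ?A s"
      using step that r_def by auto
    ultimately show "P s" by blast
  qed
  then have wf_lex: "wf ({(g, f). gt f g} <*lex*> mult r <*lex*> {(b, a :: enat). b < a})"
    using wf_gt by (intro wf_lex_prod wf_mult wf) (simp_all add: wfp_def)
  have "(\<forall>t. t \<in># M \<longrightarrow> ?A t) \<longrightarrow> ?A (MFun f a M)"
  proof (induction "(f, M, a)" arbitrary: f M a rule: wf_induct_rule[OF wf_lex])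
    case 1
    note IH = 1
    show ?case
    proof (rule impI, rule accp.intros)
      fix u
      assume args: "\<forall>t. t \<in># M \<longrightarrow> ?A t" and "(mstep gt)\<inverse>\<inverse> u (MFun f a M)"
      then have "mstep gt (MFun f a M) u" by simp
      then show "?A u"
      proof cases
        case select
        then show ?thesis using args by blast
      next
        case (relabel b)
        then show ?thesis using IH args by simp
      next
        case (copy g b c n)
        \<comment> \<open>The smaller label makes the copied argument accessible; afterwards the
          smaller symbol \<open>g\<close> handles the new root.\<close>
        then have "?A (MFun f b M)" using IH args by simp
        then have "\<forall>t. t \<in># replicate_mset n (MFun f b M) \<longrightarrow> ?A t"
          by simp
        then show ?thesis using IH copy by simp
      next
        case (arg K t M' b)
        have t: "?A t" using args arg by simp
        then have K: "?A k" if "k \<in># K" for k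
          using arg(3)[OF that] accp_downward by fastforce
        have "(M' + K, M) \<in> mult1 r"
          unfolding mult1_def using arg t by (auto simp: r_def)
        then have "(M' + K, M) \<in> mult r"
          by (simp add: mult_def)
        moreover have "\<forall>t. t \<in># M' + K \<longrightarrow> ?A t"
          using args arg K by auto
        ultimately show ?thesis using IH arg by simp
      qed
    qed
  qed
  then show ?thesis using assms(2) by blast
qed

lemma wfp_mstep:
  assumes "wfp (\<lambda>g f. gt f g)"
  shows "wfp (mstep gt :: ('f, 'v) mtree \<Rightarrow> _)\<inverse>\<inverse>"
proof (rule accp_wfpI, rule allI)
  fix t :: "('f, 'v) mtree"
  show "Wellfounded.accp (mstep gt)\<inverse>\<inverse> t"
  proof (induction t)
    case (MVar x)
    show ?case by (rule accp.intros) (auto elim: mstep_MVarE)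
  next
    case (MFun f a M)
    then show ?case using accp_mstep_MFun[OF assms] by blast
  qed
qed

lemma mstep_acyclic:
  assumes "wfp (\<lambda>g f. gt f g)"
  shows "\<not> (mstep gt)\<^sup>+\<^sup>+ t t"
proof
  assume "(mstep gt)\<^sup>+\<^sup>+ t t"
  then have "((mstep gt)\<inverse>\<inverse>)\<^sup>+\<^sup>+ t t"
    by (simp add: tranclp_converse)
  moreover have "wfp ((mstep gt)\<inverse>\<inverse>)\<^sup>+\<^sup>+"
    using wfp_mstep[OF assms] by (rule wfp_tranclp)
  ultimately show False
    by (meson wfp_imp_irreflp irreflpD)
qed

section \<open>Labelled reduction inside arguments\<close>

lemma mstep_single:
  "mstep gt s t \<Longrightarrow> mstep gt (MFun f a (add_mset s M)) (MFun f a (add_mset t M))"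
  using arg[of "{#t#}" gt s f a M a] by simp

lemma mstep_tranclp_single:
  assumes "(mstep gt)\<^sup>+\<^sup>+ s t"
  shows "(mstep gt)\<^sup>+\<^sup>+ (MFun f a (add_mset s M)) (MFun f a (add_mset t M))"
  using assms by induction (auto intro: mstep_single tranclp.intros)

lemma mstep_rtranclp_single:
  assumes "(mstep gt)\<^sup>*\<^sup>* s t"
  shows "(mstep gt)\<^sup>*\<^sup>* (MFun f a (add_mset s M)) (MFun f a (add_mset t M))"
  using assms by induction (auto intro: mstep_single rtranclp.intros)

lemma mstep_rtranclp_args:
  assumes "\<And>t. t \<in> set ts \<Longrightarrow> (mstep gt)\<^sup>*\<^sup>* (\<phi> t) (\<psi> t)"
  shows "(mstep gt)\<^sup>*\<^sup>* (MFun f a (M + mset (map \<phi> ts))) (MFun f a (M + mset (map \<psi> ts)))"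
  using assms
proof (induction ts arbitrary: M)
  case (Cons t ts)
  have "(mstep gt)\<^sup>*\<^sup>* (MFun f a (M + mset (map \<phi> (t # ts))))
      (MFun f a (add_mset (\<psi> t) M + mset (map \<phi> ts)))"
    using mstep_rtranclp_single[of gt "\<phi> t" "\<psi> t" f a "M + mset (map \<phi> ts)"] Cons.prems by simp
  also have "(mstep gt)\<^sup>*\<^sup>* \<dots> (MFun f a (add_mset (\<psi> t) M + mset (map \<psi> ts)))"
    using Cons.prems by (intro Cons.IH) simp
  finally show ?case by simp
qed simp

section \<open>Terms as trees with a uniform star label\<close>

primrec base :: "'f sym \<Rightarrow> 'f" where
  "base (Plain f) = f"
| "base (Starred f) = f"

primrec label :: "nat \<Rightarrow> 'f sym \<Rightarrow> enat" where
  "label n (Plain f) = \<infinity>"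
| "label n (Starred f) = enat n"

primrec mtree_of :: "nat \<Rightarrow> ('f sym, 'v) trm \<Rightarrow> ('f, 'v) mtree" where
  "mtree_of n (Var x) = MVar x"
| "mtree_of n (Fun h ts) = MFun (base h) (label n h) (mset (map (mtree_of n) ts))"

lemma mtree_of_perm_equiv:
  assumes "perm_equiv G V s t"
  shows "mtree_of n s = mtree_of n t"
proof -
  have step: "mtree_of n u = mtree_of n v" if uv: "rstep G V (swap_rules G V) u v" for u v
    using uv
  proof cases
    case (1 l r C \<sigma>)
    from 1(3) have "mtree_of n (subst \<sigma> l) = mtree_of n (subst \<sigma> r)"
      by cases simp
    then have "mtree_of n (fill C (subst \<sigma> l)) = mtree_of n (fill C (subst \<sigma> r))"
      by (induction C) simp_all
    then show ?thesis using 1 by simp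
  qed
  from assms show ?thesis
    unfolding perm_equiv_def by (induction rule: equivclp_induct) (auto dest: step)
qed

lemma mtree_of_star_free:
  assumes "t \<in> terms (Plain ` F) V"
  shows "mtree_of m t = mtree_of n t"
  using assms by induction (auto intro: image_mset_cong)

lemma mstep_label:
  "(mstep gt)\<^sup>*\<^sup>* (MFun (base h) (label (Suc n) h) M) (MFun (base h) (label n h) M)"
  by (cases h) (auto intro!: r_into_rtranclp relabel)

text \<open>The label is uniform, so stars outside the redex must drop from \<open>Suc n\<close> to
  \<open>n\<close> as well.\<close>

lemma mtree_of_Suc: "(mstep gt)\<^sup>*\<^sup>* (mtree_of (Suc n) t) (mtree_of n t)"
proof (induction t)
  case (Fun h ts)
  then have "(mstep gt)\<^sup>*\<^sup>* (mtree_of (Suc n) (Fun h ts))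
      (MFun (base h) (label (Suc n) h) (mset (map (mtree_of n) ts)))"
    using mstep_rtranclp_args[of ts gt "mtree_of (Suc n)" "mtree_of n" _ _ "{#}"] by simp
  also have "(mstep gt)\<^sup>*\<^sup>* \<dots> (mtree_of n (Fun h ts))"
    using mstep_label by simp
  finally show ?case .
qed simp

lemma mtree_of_Suc_args:
  "(mstep gt)\<^sup>*\<^sup>* (MFun f a (M + mset (map (mtree_of (Suc n)) ts)))
     (MFun f a (M + mset (map (mtree_of n) ts)))"
  by (intro mstep_rtranclp_args mtree_of_Suc)

text \<open>Strictness comes from the hole; siblings and symbols above it are merely
  relabelled.\<close>

lemma mstep_fill:
  assumes "(mstep gt)\<^sup>+\<^sup>+ (mtree_of (Suc n) s) (mtree_of n t)"
  shows "(mstep gt)\<^sup>+\<^sup>+ (mtree_of (Suc n) (fill C s)) (mtree_of n (fill C t))"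
proof (induction C)
  case Hole
  show ?case using assms by simp
next
  case (More h ss C ts)
  let ?f = "MFun (base h) (label (Suc n) h)"
  have "(mstep gt)\<^sup>*\<^sup>* (mtree_of (Suc n) (fill (More h ss C ts) s))
      (?f (add_mset (mtree_of (Suc n) (fill C s)) (mset (map (mtree_of n) (ss @ ts)))))"
    using mtree_of_Suc_args[of gt _ _ "{#mtree_of (Suc n) (fill C s)#}" n "ss @ ts"] by simp
  also have "(mstep gt)\<^sup>+\<^sup>+ \<dots>
      (?f (add_mset (mtree_of n (fill C t)) (mset (map (mtree_of n) (ss @ ts)))))"
    by (rule mstep_tranclp_single[OF More.IH])
  also have "(mstep gt)\<^sup>*\<^sup>* \<dots> (mtree_of n (fill (More h ss C ts) t))"
    using mstep_label by simp
  finally show ?case .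
qed

section \<open>Lifting \<open>Star\<close> reductions\<close>

lemma star_rules_mstep:
  assumes "(l, r) \<in> star_rules F V gt"
  shows "(mstep (\<lambda>f g. f \<in> F \<and> g \<in> F \<and> gt f g))\<^sup>+\<^sup>+
    (mtree_of (Suc n) (subst \<sigma> l)) (mtree_of n (subst \<sigma> r))"
proof -
  let ?gt = "\<lambda>f g. f \<in> F \<and> g \<in> F \<and> gt f g"
  obtain h ts where l: "l = Fun h ts"
    using assms by cases auto
  \<comment> \<open>Everything below the root is lowered to \<open>n\<close> first; then a single
    labelled step at the root remains.\<close>
  let ?u = "MFun (base h) (label (Suc n) h) (mset (map (mtree_of n) (map (subst \<sigma>) ts)))"
  have "(mstep ?gt)\<^sup>*\<^sup>* (mtree_of (Suc n) (subst \<sigma> l)) ?u"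
    using mtree_of_Suc_args[of ?gt _ _ "{#}" n "map (subst \<sigma>) ts"] l by simp
  also from assms have "mstep ?gt ?u (mtree_of n (subst \<sigma> r))"
  proof cases
    case (put f xs)
    show ?thesis using l unfolding put(1,2) by (auto simp: multiset.map_comp comp_def intro!: relabel)
  next
    case (select f xs y zs)
    show ?thesis using l unfolding select(1,2) by (auto intro!: mstep.select)
  next
    case (copy f g xs k)
    have "mstep ?gt (MFun f (enat (Suc n)) M) (MFun g \<infinity> (replicate_mset k (MFun f (enat n) M)))" for M
      by (rule mstep.copy) (use copy in auto)
    then show ?thesis using l unfolding copy(1,2) by (auto simp: multiset.map_comp comp_def)
  next
    case (down f g xs ys zs k)
    let ?m = "\<lambda>xs. mset (map (\<lambda>x. mtree_of n (\<sigma> x)) xs)"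
    \<comment> \<open>In \<open>arg\<close>, \<open>K\<close> consists of the \<open>k\<close>
      copies, each one \<open>relabel\<close> step below the argument with root \<open>g\<close>,
      and the root label may rise to \<infinity>.\<close>
    have "mstep ?gt (MFun f (enat (Suc n)) (add_mset (MFun g \<infinity> (?m ys)) (?m xs + ?m zs)))
        (MFun f \<infinity> (?m xs + ?m zs + replicate_mset k (MFun g (enat n) (?m ys))))"
      by (rule mstep.arg) (simp add: relabel split: if_splits)
    then show ?thesis
      using l unfolding down(1,2) by (auto simp: multiset.map_comp comp_def ac_simps)
  qed
  finally (rtranclp_into_tranclp1) show ?thesis .
qed

lemma star_step_mstep:
  assumes "star_step F V gt s t"
  shows "(mstep (\<lambda>f g. f \<in> F \<and> g \<in> F \<and> gt f g))\<^sup>+\<^sup>+ (mtree_of (Suc n) s) (mtree_of n t)"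
  using assms unfolding star_step_def
proof cases
  case (1 l r C \<sigma>)
  then show ?thesis using mstep_fill[OF star_rules_mstep[OF 1(3)]] by blast
qed

text \<open>Going backwards from label 0 at the end, each step raises the label by one;
  \<open>k\<close> counts the steps.\<close>

lemma star_steps_mstep:
  assumes "(star_step F V gt)\<^sup>+\<^sup>+ s t"
  shows "\<exists>k. (mstep (\<lambda>f g. f \<in> F \<and> g \<in> F \<and> gt f g))\<^sup>+\<^sup>+ (mtree_of k s) (mtree_of 0 t)"
  using assms
proof (induction rule: converse_tranclp_induct)
  case (base s)
  then show ?case using star_step_mstep by blast
next
  case (step s u)
  then obtain k where "(mstep (\<lambda>f g. f \<in> F \<and> g \<in> F \<and> gt f g))\<^sup>+\<^sup>+ (mtree_of k u) (mtree_of 0 t)"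
    by blast
  with star_step_mstep[OF step.hyps(1), of k] show ?case
    by (blast intro: tranclp_trans)
qed

theorem lemma4p18:
  fixes F :: "'f set" and V :: "'v set" and gt :: "'f \<Rightarrow> 'f \<Rightarrow> bool"
  assumes "infinite V"
    and "irreflp_on F gt" and "transp_on F gt" and "wfp_on F (\<lambda>g f. gt f g)"
  shows "\<not> (\<exists>t \<in> terms (Plain ` F) V.
    ((star_step F V gt)\<^sup>+\<^sup>+ OO perm_equiv (star_sig F) V) t t)"
proof (intro notI, elim bexE relcomppE)
  fix t t'
  assume t: "t \<in> terms (Plain ` F) V"
    and steps: "(star_step F V gt)\<^sup>+\<^sup>+ t t'" and equiv: "perm_equiv (star_sig F) V t' t"
  \<comment> \<open>Restricting \<open>gt\<close> to \<open>F\<close> turns well-foundedness on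
    \<open>F\<close> into \<open>wfp\<close> on the whole type.\<close>
  let ?gt = "\<lambda>f g. f \<in> F \<and> g \<in> F \<and> gt f g"
  from star_steps_mstep[OF steps] obtain k
    where "(mstep ?gt)\<^sup>+\<^sup>+ (mtree_of k t) (mtree_of 0 t')" by blast
  moreover have "mtree_of k t = mtree_of 0 t'"
    using mtree_of_star_free[OF t] mtree_of_perm_equiv[OF equiv] by metis
  moreover have "wfp (\<lambda>g f. ?gt f g)"
    using wfp_on_iff_wfp[THEN iffD1, OF assms(4)] by (simp add: conj_ac)
  ultimately show False
    using mstep_acyclic[of ?gt "mtree_of 0 t'"] by simp
qed

end
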